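(* Let $G=(V,E)$ be a $(2t+1)$ edge-connected graph of diameter $D$ with a source node $s$ holding a message $m_0$, and let $L$ be a parameter such that for every $u,v\in V$ and every $E'\subseteq E$ with $|E'|\le 2t$, $\mathrm{dist}_{G\setminus E'}(u,v)\le L$. Assuming the nodes locally know an $(L,2t)$ covering family $\mathcal{G}$ of $G$ (and know $L$ and $t$), there exists a deterministic broadcast algorithm in the adversarial \textsc{CONGEST} model against $t$ adversarial edges with round complexity $O(L\cdot|\mathcal{G}|)$.
   Context: An $(L,k)$ covering family of $G$ is a family of subgraphs $\mathcal{G}=\{G_1,\dots,G_\ell\}$, $G_i\subseteq G$, such that for every $u,v\in V$, every set $E'\subseteq E$ with $|E'|\le k$, and every $u$-$v$ path $P\subseteq G\setminus E'$ of length at most $L$, there is some $G_i$ with $P\subseteq G_i$ and $E'\cap G_i=\emptyset$. An ordered family $\mathcal{G}$ is locally known if, given the identifier of an edge $e=(u,v)$ and an index $i$, the nodes $u,v$ can locally determine whether $e\in G_i$. Adversarial CONGEST model: $n$-node network $G$, unique $O(\log n)$-bit IDs, each node initially knows its incident edges' identifiers and a polynomial estimate of $n$; synchronous rounds with $O(\log n)$-bit messages per edge per round; a computationally unbounded adaptive adversary, knowing topology, protocol and random coins, controls a fixed set $F$ of at most $t$ edges unknown to the nodes (nodes know $t$), and may send arbitrary messages over them (possibly different per direction) based on all communication so far. Broadcast: all nodes must output $m_0$, ignoring all other messages. *)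

theory Defs
  imports Complex_Main "HOL-Library.Extended_Nat"
begin

section \<open>Undirected simple graphs\<close>

record 'v ugraph =
  verts :: "'v set"
  edges :: "'v set set"

definition wf_ugraph :: "'v ugraph \<Rightarrow> bool" where
  "wf_ugraph G \<longleftrightarrow> finite (verts G) \<and> (\<forall>e\<in>edges G. e \<subseteq> verts G \<and> card e = 2)"

definition subgraph :: "'v ugraph \<Rightarrow> 'v ugraph \<Rightarrow> bool" where
  "subgraph H G \<longleftrightarrow> wf_ugraph H \<and> verts H \<subseteq> verts G \<and> edges H \<subseteq> edges G"

definition del_edges :: "'v ugraph \<Rightarrow> 'v set set \<Rightarrow> 'v ugraph" where
  "del_edges G E' = G\<lparr>edges := edges G - E'\<rparr>"

text \<open>A path is the list of its vertices, so its length is \<open>length p - 1\<close>;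
  the one-vertex path is included.\<close>

definition is_path :: "'v ugraph \<Rightarrow> 'v \<Rightarrow> 'v list \<Rightarrow> 'v \<Rightarrow> bool" where
  "is_path G u p v \<longleftrightarrow> p \<noteq> [] \<and> hd p = u \<and> last p = v \<and> distinct p \<and>
     set p \<subseteq> verts G \<and> successively (\<lambda>x y. {x, y} \<in> edges G) p"

definition path_len :: "'v list \<Rightarrow> nat" where
  "path_len p = length p - 1"

text \<open>The distance is \<open>\<infinity>\<close> if there is no path.\<close>

definition gdist :: "'v ugraph \<Rightarrow> 'v \<Rightarrow> 'v \<Rightarrow> enat" where
  "gdist G u v = (INF p\<in>{p. is_path G u p v}. enat (path_len p))"

definition diameter :: "'v ugraph \<Rightarrow> enat" where
  "diameter G = (SUP (u, v)\<in>verts G \<times> verts G. gdist G u v)"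

definition connected_graph :: "'v ugraph \<Rightarrow> bool" where
  "connected_graph G \<longleftrightarrow> (\<forall>u\<in>verts G. \<forall>v\<in>verts G. \<exists>p. is_path G u p v)"

definition edge_connected :: "nat \<Rightarrow> 'v ugraph \<Rightarrow> bool" where
  "edge_connected k G \<longleftrightarrow>
     (\<forall>E'\<subseteq>edges G. card E' < k \<longrightarrow> connected_graph (del_edges G E'))"

definition covering_family :: "nat \<Rightarrow> nat \<Rightarrow> 'v ugraph \<Rightarrow> 'v ugraph list \<Rightarrow> bool" where
  "covering_family L k G Gs \<longleftrightarrow>
     (\<forall>H\<in>set Gs. subgraph H G) \<and>
     (\<forall>u\<in>verts G. \<forall>v\<in>verts G. \<forall>E'\<subseteq>edges G. \<forall>p.
        card E' \<le> k \<longrightarrow> is_path (del_edges G E') u p v \<longrightarrow> path_len p \<le> L \<longrightarrow>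
        (\<exists>H\<in>set Gs. is_path H u p v \<and> E' \<inter> edges H = {}))"


section \<open>The adversarial CONGEST model\<close>

text \<open>Nodes are identified with their identifiers, so the vertices of a network are natural
  numbers, and the identifier of an edge is the set of the identifiers of its endpoints.
  Messages are bit strings, and all \<open>O(log n)\<close> bounds are expressed as constant multiples of
  \<open>\<lceil>log\<^sub>2 (n + 1)\<rceil>\<close>, which stays positive for \<open>n = 1\<close>.\<close>

type_synonym msg = "bool list"

definition lg :: "nat \<Rightarrow> nat" where
  "lg n = nat \<lceil>log 2 (real n + 1)\<rceil>"

text \<open>Initial knowledge of a node. The \<open>i\<close>-th entry of \<open>my_family\<close> consists of the incident
  edges that belong to the \<open>i\<close>-th subgraph of the family; in particular the number of subgraphs
  is known. The field \<open>my_source_msg\<close> is \<open>None\<close> for all nodes but the source.\<close>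

record node_input =
  my_id :: nat
  my_edges :: "nat set set"
  my_n_estimate :: nat
  my_t :: nat
  my_L :: nat
  my_family :: "nat set set list"
  my_source_msg :: "msg option"

definition node_input ::
    "nat ugraph \<Rightarrow> nat \<Rightarrow> msg \<Rightarrow> nat \<Rightarrow> nat \<Rightarrow> nat \<Rightarrow> nat ugraph list \<Rightarrow> nat \<Rightarrow> node_input" where
  "node_input G s m\<^sub>0 N t L Gs v =
     \<lparr>my_id = v,
      my_edges = {e \<in> edges G. v \<in> e},
      my_n_estimate = N,
      my_t = t,
      my_L = L,
      my_family = map (\<lambda>H. {e \<in> edges H. v \<in> e}) Gs,
      my_source_msg = (if v = s then Some m\<^sub>0 else None)\<rparr>"

text \<open>A deterministic algorithm is given by what a node does as a function of its initial
  knowledge and of everything it has received so far: one inbox per elapsed round, mapping each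
  neighbour to the message received from it, if any. \<open>send\<close> maps each neighbour to the
  message sent to it in the current round, if any. As soon as \<open>decision\<close> is not \<open>None\<close>, the
  node terminates with that output.\<close>

type_synonym inbox = "nat \<Rightarrow> msg option"

record protocol =
  send :: "node_input \<Rightarrow> inbox list \<Rightarrow> nat \<Rightarrow> msg option"
  decision :: "node_input \<Rightarrow> inbox list \<Rightarrow> msg option"

text \<open>The messages of one round, indexed by sender and receiver.\<close>

type_synonym round_msgs = "nat \<Rightarrow> nat \<Rightarrow> msg option"

text \<open>The adversary determines what is delivered over its edges, separately in each direction,
  from the messages sent and delivered in all previous rounds and the messages sent in the
  current round. It is fixed after the network and the protocol, hence it may depend on them.\<close>

type_synonym adversary = "(round_msgs \<times> round_msgs) list \<Rightarrow> round_msgs \<Rightarrow> round_msgs"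

definition sent_msgs ::
    "protocol \<Rightarrow> (nat \<Rightarrow> node_input) \<Rightarrow> nat ugraph \<Rightarrow> (nat \<Rightarrow> inbox list) \<Rightarrow> round_msgs" where
  "sent_msgs P I G h u v =
     (if {u, v} \<in> edges G \<and> decision P (I u) (h u) = None then send P (I u) (h u) v else None)"

definition delivered_msgs ::
    "nat ugraph \<Rightarrow> nat set set \<Rightarrow> adversary \<Rightarrow> (round_msgs \<times> round_msgs) list \<Rightarrow>
     round_msgs \<Rightarrow> round_msgs" where
  "delivered_msgs G F A tr x u v =
     (if {u, v} \<in> edges G \<inter> F then A tr x u v else x u v)"

text \<open>The state after the given number of rounds: the inboxes of every node, and the list of sent
  and delivered messages of every round. The inboxes of a terminated node no longer change, so
  that its output is final.\<close>

primrec exec ::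
    "protocol \<Rightarrow> (nat \<Rightarrow> node_input) \<Rightarrow> nat ugraph \<Rightarrow> nat set set \<Rightarrow> adversary \<Rightarrow> nat \<Rightarrow>
     (nat \<Rightarrow> inbox list) \<times> (round_msgs \<times> round_msgs) list" where
  "exec P I G F A 0 = (\<lambda>_. [], [])"
| "exec P I G F A (Suc r) =
     (let (h, tr) = exec P I G F A r;
          x = sent_msgs P I G h;
          y = delivered_msgs G F A tr x
      in (\<lambda>v. if decision P (I v) (h v) = None then h v @ [\<lambda>u. y u v] else h v, tr @ [(x, y)]))"

definition output_after ::
    "protocol \<Rightarrow> (nat \<Rightarrow> node_input) \<Rightarrow> nat ugraph \<Rightarrow> nat set set \<Rightarrow> adversary \<Rightarrow> nat \<Rightarrow> nat \<Rightarrow>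
     msg option" where
  "output_after P I G F A r v = decision P (I v) (fst (exec P I G F A r) v)"

definition respects_bandwidth ::
    "protocol \<Rightarrow> (nat \<Rightarrow> node_input) \<Rightarrow> nat ugraph \<Rightarrow> nat set set \<Rightarrow> adversary \<Rightarrow> nat \<Rightarrow> bool" where
  "respects_bandwidth P I G F A B \<longleftrightarrow>
     (\<forall>r u v m. sent_msgs P I G (fst (exec P I G F A r)) u v = Some m \<longrightarrow> length m \<le> B)"

definition adversary_respects_bandwidth :: "adversary \<Rightarrow> nat \<Rightarrow> bool" where
  "adversary_respects_bandwidth A B \<longleftrightarrow> (\<forall>tr x u v m. A tr x u v = Some m \<longrightarrow> length m \<le> B)"

text \<open>With node identifiers and the broadcast message of at most \<open>c\<^sub>i\<^sub>d \<cdot> lg n\<close> and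
  \<open>c\<^sub>m \<cdot> lg n\<close> bits, and an estimate \<open>N\<close> that is polynomially related to \<open>n\<close> with
  exponent \<open>c\<^sub>e\<close>.\<close>

definition congest_network ::
    "nat \<Rightarrow> nat \<Rightarrow> nat \<Rightarrow> nat ugraph \<Rightarrow> nat \<Rightarrow> msg \<Rightarrow> nat \<Rightarrow> bool" where
  "congest_network c\<^sub>i\<^sub>d c\<^sub>m c\<^sub>e G s m\<^sub>0 N \<longleftrightarrow>
     (let n = card (verts G)
      in wf_ugraph G \<and> s \<in> verts G \<and>
         (\<forall>v\<in>verts G. v < 2 ^ (c\<^sub>i\<^sub>d * lg n)) \<and>
         length m\<^sub>0 \<le> c\<^sub>m * lg n \<and>
         n \<le> N ^ c\<^sub>e \<and> N \<le> n ^ c\<^sub>e)"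

text \<open>Broadcast on the given network, with bandwidth \<open>B\<close> per edge and direction, against every
  adversary controlling at most \<open>t\<close> edges: all nodes terminate within \<open>T\<close> rounds with
  output \<open>m\<^sub>0\<close>.\<close>

definition broadcasts ::
    "protocol \<Rightarrow> (nat \<Rightarrow> node_input) \<Rightarrow> nat ugraph \<Rightarrow> msg \<Rightarrow> nat \<Rightarrow> nat \<Rightarrow> nat \<Rightarrow> bool" where
  "broadcasts P I G m\<^sub>0 t B T \<longleftrightarrow>
     (\<forall>F A. F \<subseteq> edges G \<and> card F \<le> t \<and> adversary_respects_bandwidth A B \<longrightarrow>
        respects_bandwidth P I G F A B \<and>
        (\<forall>v\<in>verts G. output_after P I G F A T v = Some m\<^sub>0))"

end

theory Submission
  imports Defs
begin

text \<open>For each subgraph of the family, \<open>2L\<close> rounds are reserved in which \<open>m\<^sub>0\<close> is flooded through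
  that subgraph. The first neighbour from which a node receives something becomes its parent. The
  source sends the one-item stream \<open>[m\<^sub>0]\<close>; every other node sends the identifier of its parent
  followed by the stream that it receives from its parent. So a node at depth \<open>d\<close> receives the
  identifiers of its proper ancestors, one per round, and then the message, and it ends up with a
  message together with a claimed path to the source. If no edge of the claimed path is adversarial,
  then the message is \<open>m\<^sub>0\<close>. Conversely, for every set \<open>E'\<close> of \<open>t\<close> edges, the covering property for
  \<open>E' \<union> F\<close> gives a subgraph in which the flooding is undisturbed and yields a claimed path that
  avoids \<open>E'\<close>. Hence \<open>m\<^sub>0\<close> is the only message \<open>m\<close> such that every set of at most \<open>t\<close> edges is
  avoided by some claimed path with message \<open>m\<close>.\<close>

section \<open>Flooding through one subgraph\<close>

fun bits :: "nat \<Rightarrow> bool list" where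
  "bits n = (if n = 0 then [] else odd n # bits (n div 2))"

declare bits.simps [simp del]

text \<open>Injectivity replaces a decoder: \<open>claim\<close> only compares received strings with
  encodings.\<close>

lemma inj_bits: "inj bits"
proof (rule injI)
  show "bits m = bits n \<Longrightarrow> m = n" for m n
  proof (induction m arbitrary: n rule: less_induct)
    case (less m)
    show ?case
    proof (cases "m = 0 \<or> n = 0")
      case True
      then show ?thesis using less.prems by (auto simp: bits.simps[of m] bits.simps[of n] split: if_splits)
    next
      case False
      then have "odd m = odd n" "bits (m div 2) = bits (n div 2)"
        using less.prems by (auto simp: bits.simps[of m] bits.simps[of n])
      moreover from this have "m div 2 = n div 2" using less.IH False by simp
      ultimately show ?thesis by (metis even_two_times_div_two odd_two_times_div_two_succ)
    qed
  qed
qed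

lemma length_bits_le: "n < 2 ^ c \<Longrightarrow> length (bits n) \<le> c"
proof (induction c arbitrary: n)
  case 0
  then show ?case by (simp add: bits.simps)
next
  case (Suc c)
  then show ?case by (subst bits.simps) auto
qed

fun path_edges :: "'v list \<Rightarrow> 'v set set" where
  "path_edges (x # y # p) = insert {x, y} (path_edges (y # p))"
| "path_edges _ = {}"

text \<open>In the following definitions, \<open>g r u\<close> is what a node receives from \<open>u\<close> in round \<open>r\<close>.
  The first bit of a message tells identifiers from the broadcast message.\<close>

definition first_round :: "(nat \<Rightarrow> inbox) \<Rightarrow> nat" where
  "first_round g = (LEAST r. \<exists>u. g r u \<noteq> None)"

definition parent :: "(nat \<Rightarrow> inbox) \<Rightarrow> nat" where
  "parent g = (LEAST u. g (first_round g) u \<noteq> None)"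

text \<open>Forwarding takes two rounds per hop: one for the transmission itself, one for the
  inserted identifier. The last branch is reached only for \<open>r\<close> at least
  \<open>first_round g + 2\<close>, so \<open>r - 2\<close> never truncates.\<close>

definition relay :: "msg option \<Rightarrow> (nat \<Rightarrow> inbox) \<Rightarrow> nat \<Rightarrow> msg option" where
  "relay src g r = (case src of
     Some m \<Rightarrow> if r = 0 then Some (False # m) else None
   | None \<Rightarrow> if \<forall>j<r. \<forall>u. g j u = None then None
             else if r = Suc (first_round g) then Some (True # bits (parent g))
             else g (r - 2) (parent g))"

text \<open>The ancestors \<open>qs\<close> do not include the parent, and the last of them is supposed to be the
  source.\<close>

definition claim :: "(nat \<Rightarrow> inbox) \<Rightarrow> nat list \<Rightarrow> msg \<Rightarrow> bool" where
  "claim g qs m \<longleftrightarrow>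
     (\<forall>k<length qs. g (first_round g + k) (parent g) = Some (True # bits (qs ! k))) \<and>
     g (first_round g + length qs) (parent g) = Some (False # m)"

lemma first_round_le: "g r u \<noteq> None \<Longrightarrow> first_round g \<le> r"
  unfolding first_round_def by (rule Least_le) blast

lemma first_round_parent:
  assumes "g r u \<noteq> None"
  shows "g (first_round g) (parent g) \<noteq> None"
proof -
  have "\<exists>r u. g r u \<noteq> None" using assms by blast
  then have "\<exists>u. g (first_round g) u \<noteq> None" unfolding first_round_def by (rule LeastI_ex)
  then show ?thesis unfolding parent_def by (rule LeastI_ex)
qed

lemma first_round_eqI:
  assumes "g a u \<noteq> None" "\<And>j v. j < a \<Longrightarrow> g j v = None"
  shows "first_round g = a"
  unfolding first_round_def
proof (rule Least_equality)
  show "\<exists>u. g a u \<noteq> None" using assms(1) by (rule exI)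
  fix y assume "\<exists>u. g y u \<noteq> None"
  then obtain w where "g y w \<noteq> None" ..
  then show "a \<le> y" using assms(2)[of y w] by (cases "y < a") simp_all
qed

text \<open>Causality: \<open>first_round\<close> and \<open>parent\<close> look at all rounds, but
  once something has arrived before round \<open>r\<close>, the rounds before \<open>r\<close>
  determine them.\<close>

lemma relay_cong:
  assumes "\<And>j. j < r \<Longrightarrow> g j = g' j"
  shows "relay src g r = relay src g' r"
proof (cases "\<forall>j<r. \<forall>u. g j u = None")
  case True
  then show ?thesis using assms by (auto simp: relay_def split: option.split)
next
  case False
  then obtain j u where j: "j < r" "g j u \<noteq> None" by blast
  have fr: "first_round g < r" using first_round_le[of g j u] j by simp
  have "first_round g' = first_round g"
  proof (rule first_round_eqI)
    show "g' (first_round g) (parent g) \<noteq> None"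
      using first_round_parent[of g j u] j assms fr by metis
    show "g' i v = None" if "i < first_round g" for i v
      using that first_round_le[of g i v] assms[of i] fr by (metis leD less_trans)
  qed
  moreover from this have "parent g' = parent g" using assms fr by (simp add: parent_def)
  ultimately show ?thesis using assms False fr
    by (auto simp: relay_def split: option.split)
qed

text \<open>The strict bounds leave room for the tag bit; forwarded messages already carry theirs
  and do not grow.\<close>

lemma relay_length:
  assumes "relay src g r = Some m"
    and "\<And>m. src = Some m \<Longrightarrow> length m < B"
    and "\<And>j u. g j u \<noteq> None \<Longrightarrow> length (bits u) < B"
    and "\<And>j u m. g j u = Some m \<Longrightarrow> length m \<le> B"
  shows "length m \<le> B"
proof (cases src)
  case (Some m')
  then show ?thesis using assms(1) assms(2)[OF Some] by (auto simp: relay_def split: if_splits)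
next
  case None
  then obtain j u where "g j u \<noteq> None" using assms(1) by (auto simp: relay_def split: if_splits)
  then have "length (bits (parent g)) < B" using first_round_parent[of g j u] assms(3) by blast
  then show ?thesis using None assms(1) assms(4) by (auto simp: relay_def split: if_splits)
qed

section \<open>Claimed paths in a single phase\<close>

text \<open>The adversary enters only through what is not assumed: over edges in \<open>F\<close>,
  anything may arrive during the \<open>K\<close> rounds.\<close>

locale flood_phase =
  fixes E F :: "nat set set" and s :: nat and m\<^sub>0 :: msg and K :: nat
    and rcv :: "nat \<Rightarrow> nat \<Rightarrow> inbox"
  assumes rcv_edge: "rcv v r u \<noteq> None \<Longrightarrow> {u, v} \<in> E \<and> r < K"
    and rcv_honest: "{u, v} \<in> E \<Longrightarrow> {u, v} \<notin> F \<Longrightarrow> r < K \<Longrightarrow>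
      rcv v r u = relay (if u = s then Some m\<^sub>0 else None) (rcv u) r"
begin

lemma rcv_from_source:
  assumes "{s, v} \<in> E" "{s, v} \<notin> F" "r < K"
  shows "rcv v r s = (if r = 0 then Some (False # m\<^sub>0) else None)"
  using rcv_honest[OF assms] by (simp add: relay_def)

text \<open>Over an honest edge to its parent, a node hears from the parent as soon as the parent is
  reached, and from then on it receives the stream of the parent with a delay of two rounds.\<close>

lemma rcv_from_parent:
  assumes "rcv v r u \<noteq> None" "{parent (rcv v), v} \<notin> F" "parent (rcv v) \<noteq> s"
  defines "p \<equiv> parent (rcv v)"
  shows "first_round (rcv v) = Suc (first_round (rcv p))"
    and "rcv p (first_round (rcv p)) (parent (rcv p)) \<noteq> None"
    and "rcv v (first_round (rcv v)) p = Some (True # bits (parent (rcv p)))"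
    and "first_round (rcv v) + Suc k < K \<Longrightarrow>
      rcv v (first_round (rcv v) + Suc k) p = rcv p (first_round (rcv p) + k) (parent (rcv p))"
proof -
  let ?a = "first_round (rcv v)" and ?b = "first_round (rcv p)"
  have some: "rcv v ?a p \<noteq> None" unfolding p_def using first_round_parent[of "rcv v"] assms by blast
  then have edge: "{p, v} \<in> E" "?a < K" using rcv_edge by blast+
  have honest: "rcv v r p = relay None (rcv p) r" if "r < K" for r
    using rcv_honest[OF edge(1) _ that] assms by simp
  obtain j w where j: "j < ?a" "rcv p j w \<noteq> None"
    using some honest[OF edge(2)] unfolding relay_def by (auto split: if_splits)
  show b: "rcv p ?b (parent (rcv p)) \<noteq> None" using first_round_parent[of "rcv p"] j by blast
  have "?b < ?a" using first_round_le[of "rcv p" j w] j by simp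
  then have sb: "rcv v (Suc ?b) p = Some (True # bits (parent (rcv p)))"
    using honest[of "Suc ?b"] edge b unfolding relay_def by auto
  then show ab: "?a = Suc ?b" using first_round_le[of "rcv v" "Suc ?b" p] \<open>?b < ?a\<close> by simp
  show "rcv v ?a p = Some (True # bits (parent (rcv p)))" using sb ab by simp
  assume "?a + Suc k < K"
  moreover have "\<not> (\<forall>j<?a + Suc k. \<forall>u. rcv p j u = None)"
    using b ab by (metis less_add_Suc1 less_add_Suc2 not_less_eq trans_less_add1)
  ultimately show "rcv v (?a + Suc k) p = rcv p (?b + k) (parent (rcv p))"
    using honest[of "?a + Suc k"] ab by (simp add: relay_def)
qed

text \<open>An honest parent passes on its own claim with the identifier of its parent prepended;
  peeling that off moves one vertex towards the source. Lies away from the claimed path do no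
  harm.\<close>

lemma claim_sound:
  assumes "claim (rcv v) qs m" "path_edges (v # parent (rcv v) # qs) \<inter> F = {}"
  shows "m = m\<^sub>0"
  using assms
proof (induction qs arbitrary: v)
  case Nil
  let ?p = "parent (rcv v)" and ?a = "first_round (rcv v)"
  have r: "rcv v ?a ?p = Some (False # m)" using Nil by (simp add: claim_def)
  then have edge: "{?p, v} \<in> E" "?a < K" using rcv_edge[of v ?a ?p] by auto
  have notF: "{?p, v} \<notin> F" using Nil(2) by (simp add: insert_commute)
  \<comment> \<open>A parent other than the source would open with an item tagged
    \<open>True\<close>.\<close>
  have "?p = s" using rcv_from_parent(3)[of v ?a ?p] r notF by fastforce
  then show ?case using r rcv_from_source[of v ?a] edge notF by (auto split: if_splits)
next
  case (Cons q qs)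
  let ?p = "parent (rcv v)" and ?a = "first_round (rcv v)"
  have r: "rcv v ?a ?p = Some (True # bits q)"
    using Cons.prems(1) by (force simp: claim_def)
  then have edge: "{?p, v} \<in> E" "?a < K" using rcv_edge[of v ?a ?p] by auto
  have notF: "{?p, v} \<notin> F" using Cons.prems(2) by (simp add: insert_commute)
  have ps: "?p \<noteq> s" using r rcv_from_source[of v ?a] edge notF by (auto split: if_splits)
  have "rcv v ?a ?p \<noteq> None" using r by simp
  note step = rcv_from_parent[OF this notF ps]
  have q: "q = parent (rcv ?p)" using step(3) r inj_bits by (simp add: inj_eq)
  have shift: "rcv ?p (first_round (rcv ?p) + k) (parent (rcv ?p)) = Some x"
    if "rcv v (?a + Suc k) ?p = Some x" for k x
    using step(4)[of k] that rcv_edge[of v "?a + Suc k" ?p] by simp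
  have "claim (rcv ?p) qs m"
    unfolding claim_def
  proof (intro conjI allI impI)
    fix k assume "k < length qs"
    then show "rcv ?p (first_round (rcv ?p) + k) (parent (rcv ?p)) = Some (True # bits (qs ! k))"
      using Cons.prems(1) by (intro shift) (force simp: claim_def)
  next
    show "rcv ?p (first_round (rcv ?p) + length qs) (parent (rcv ?p)) = Some (False # m)"
      using Cons.prems(1) by (intro shift) (simp add: claim_def)
  qed
  moreover have "path_edges (?p # parent (rcv ?p) # qs) \<inter> F = {}"
    using Cons.prems(2) q by simp
  ultimately show ?case by (rule Cons.IH)
qed

text \<open>Each hop delays the first arrival by one round and lengthens the stream by one item, so
  the message arrives in round \<open>2 * first_round (rcv v)\<close>, still within the
  phase.\<close>

lemma claim_complete:
  assumes "E \<inter> F = {}" "rcv v r u \<noteq> None" "2 * first_round (rcv v) < K"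
  shows "\<exists>qs m. length qs = first_round (rcv v) \<and> claim (rcv v) qs m \<and>
    path_edges (v # parent (rcv v) # qs) \<subseteq> E"
  using assms(2,3)
proof (induction "first_round (rcv v)" arbitrary: v r u rule: less_induct)
  case less
  let ?p = "parent (rcv v)" and ?a = "first_round (rcv v)"
  have some: "rcv v ?a ?p \<noteq> None" using first_round_parent[of "rcv v"] less.prems by blast
  then have edge: "{?p, v} \<in> E" "?a < K" using rcv_edge[of v ?a ?p] by auto
  have notF: "{?p, v} \<notin> F" using edge assms(1) by blast
  show ?case
  proof (cases "?p = s")
    case True
    then have "?a = 0" using some rcv_from_source[of v ?a] edge notF by (auto split: if_splits)
    moreover from this have "rcv v 0 ?p = Some (False # m\<^sub>0)"
      using True rcv_from_source[of v 0] edge notF by simp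
    ultimately show ?thesis using edge
      by (intro exI[of _ "[]"] exI[of _ m\<^sub>0]) (simp add: claim_def insert_commute)
  next
    case False
    note step = rcv_from_parent[OF some notF False]
    have "first_round (rcv ?p) < ?a" "2 * first_round (rcv ?p) < K"
      using step(1) less.prems(2) by simp_all
    from less.hyps[OF this(1) step(2) this(2)] obtain qs m where
      qs: "length qs = first_round (rcv ?p)" "claim (rcv ?p) qs m"
        "path_edges (?p # parent (rcv ?p) # qs) \<subseteq> E" by blast
    have shift: "rcv v (?a + Suc k) ?p = rcv ?p (first_round (rcv ?p) + k) (parent (rcv ?p))"
      if "k \<le> length qs" for k
      using step(4)[of k] step(1) that qs(1) less.prems(2) by simp
    have "claim (rcv v) (parent (rcv ?p) # qs) m"
      unfolding claim_def
    proof (intro conjI allI impI)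
      fix k assume k: "k < length (parent (rcv ?p) # qs)"
      show "rcv v (?a + k) ?p = Some (True # bits ((parent (rcv ?p) # qs) ! k))"
      proof (cases k)
        case 0
        then show ?thesis using step(3) by simp
      next
        case (Suc l)
        then show ?thesis using shift[of l] k qs(2) by (simp add: claim_def)
      qed
    next
      show "rcv v (?a + length (parent (rcv ?p) # qs)) ?p = Some (False # m)"
        using shift[of "length qs"] qs(2) by (simp add: claim_def)
    qed
    then show ?thesis using qs step(1) edge
      by (intro exI[of _ "parent (rcv ?p) # qs"] exI[of _ m]) (simp add: insert_commute)
  qed
qed

text \<open>A reached node sends in the next round, so the flood advances along \<open>p\<close> by
  at least one edge per round. The parents chosen may lie off \<open>p\<close>.\<close>

lemma reached_along_path:
  assumes "E \<inter> F = {}" "distinct p" "hd p = s" "successively (\<lambda>x y. {x, y} \<in> E) p"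
    "Suc d < length p" "d < K"
  shows "\<exists>j u. j \<le> d \<and> rcv (p ! Suc d) j u \<noteq> None"
  using assms(5,6)
proof (induction d)
  case 0
  have "{s, p ! Suc 0} \<in> E"
    using assms(3,4) 0 by (cases p) (auto simp: successively_conv_nth)
  then show ?case using rcv_from_source[of "p ! Suc 0" 0] assms(1) 0
    by (intro exI[of _ 0] exI[of _ s]) auto
next
  case (Suc d)
  let ?v = "p ! Suc d" and ?w = "p ! Suc (Suc d)"
  obtain j u where j: "j \<le> d" "rcv ?v j u \<noteq> None" using Suc by auto
  let ?a = "first_round (rcv ?v)"
  have a: "?a \<le> d" using first_round_le[of "rcv ?v" j u] j by simp
  have ne: "rcv ?v ?a (parent (rcv ?v)) \<noteq> None" using first_round_parent[of "rcv ?v"] j by blast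
  have "p \<noteq> []" using Suc.prems by auto
  \<comment> \<open>The source is silent after round 0, so \<open>p\<close> must not return to
    it.\<close>
  then have "?v \<noteq> s" using assms(2,3) Suc.prems by (simp add: hd_conv_nth nth_eq_iff_index_eq flip: assms(3))
  moreover have "{?v, ?w} \<in> E" using assms(4) Suc.prems by (simp add: successively_conv_nth)
  ultimately have "rcv ?w (Suc ?a) ?v = relay None (rcv ?v) (Suc ?a)"
    using rcv_honest[of ?v ?w "Suc ?a"] assms(1) a Suc.prems by auto
  also have "\<dots> \<noteq> None" using ne by (auto simp: relay_def)
  finally show ?case using a by (intro exI[of _ "Suc ?a"] exI[of _ ?v]) auto
qed

end

section \<open>The protocol\<close>

text \<open>Discarding traffic over edges outside the current subgraph shields a subgraph without
  adversarial edges from the adversary.\<close>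

definition phase_inbox :: "node_input \<Rightarrow> inbox list \<Rightarrow> nat \<Rightarrow> nat \<Rightarrow> inbox" where
  "phase_inbox I h i r u =
     (if r < 2 * my_L I \<and> i * (2 * my_L I) + r < length h \<and> {u, my_id I} \<in> my_family I ! i
      then (h ! (i * (2 * my_L I) + r)) u else None)"

text \<open>A node does not know \<open>edges G\<close>, so \<open>E'\<close> ranges over arbitrary
  finite sets; infinite sets would have \<open>card\<close> 0.\<close>

definition accepts :: "node_input \<Rightarrow> inbox list \<Rightarrow> msg \<Rightarrow> bool" where
  "accepts I h m \<longleftrightarrow>
     (\<forall>E'. finite E' \<and> card E' \<le> my_t I \<longrightarrow>
        (\<exists>i<length (my_family I). \<exists>qs. claim (phase_inbox I h i) qs m \<and>
           path_edges (my_id I # parent (phase_inbox I h i) # qs) \<inter> E' = {}))"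

definition flood_protocol :: protocol where
  "flood_protocol = \<lparr>
     send = (\<lambda>I h u.
       let i = length h div (2 * my_L I)
       in if i < length (my_family I) \<and> {my_id I, u} \<in> my_family I ! i
          then relay (my_source_msg I) (phase_inbox I h i) (length h mod (2 * my_L I)) else None),
     decision = (\<lambda>I h.
       if length h < 2 * (my_L I * length (my_family I)) then None
       else Some (case my_source_msg I of Some m \<Rightarrow> m | None \<Rightarrow> SOME m. accepts I h m))\<rparr>"

section \<open>Executions of the protocol\<close>

locale flooding =
  fixes G :: "nat ugraph" and s :: nat and m\<^sub>0 :: msg and N t L :: nat and Gs :: "nat ugraph list"
    and F :: "nat set set" and A :: adversary
  assumes wf: "wf_ugraph G"
    and family: "\<And>H. H \<in> set Gs \<Longrightarrow> subgraph H G"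
begin

abbreviation inp :: "nat \<Rightarrow> node_input" where
  "inp \<equiv> node_input G s m\<^sub>0 N t L Gs"

abbreviation history :: "nat \<Rightarrow> nat \<Rightarrow> inbox list" where
  "history r \<equiv> fst (exec flood_protocol inp G F A r)"

abbreviation sent :: "nat \<Rightarrow> round_msgs" where
  "sent r \<equiv> sent_msgs flood_protocol inp G (history r)"

definition delivered :: "nat \<Rightarrow> round_msgs" where
  "delivered r = delivered_msgs G F A (snd (exec flood_protocol inp G F A r)) (sent r)"

abbreviation rounds :: nat where
  "rounds \<equiv> 2 * (L * length Gs)"

lemma decision_inp:
  "decision flood_protocol (inp v) h =
     (if length h < rounds then None
      else Some (if v = s then m\<^sub>0 else SOME m. accepts (inp v) h m))"
  by (simp add: flood_protocol_def node_input_def)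

lemma send_inp:
  "length h < rounds \<Longrightarrow> send flood_protocol (inp u) h v =
     (let i = length h div (2 * L)
      in if i < length Gs \<and> {u, v} \<in> edges (Gs ! i)
         then relay (if u = s then Some m\<^sub>0 else None) (phase_inbox (inp u) h i)
           (length h mod (2 * L)) else None)"
  by (auto simp: flood_protocol_def node_input_def Let_def)

text \<open>Termination depends only on the length of the history, so all nodes stop together and
  none falls silent during a phase.\<close>

lemma history_eq: "history r v = map (\<lambda>j u. delivered j u v) [0..<min r rounds]"
proof (induction r)
  case 0
  then show ?case by simp
next
  case (Suc r)
  show ?case
  proof (cases "r < rounds")
    case True
    then have "history (Suc r) v = history r v @ [\<lambda>u. delivered r u v]"
      using Suc by (simp add: Let_def case_prod_beta decision_inp delivered_def)
    then show ?thesis using Suc True by (simp add: min_def)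
  next
    case False
    then have "history (Suc r) v = history r v"
      using Suc by (simp add: Let_def case_prod_beta decision_inp)
    then show ?thesis using Suc False by (simp add: min_def)
  qed
qed

lemma length_history: "length (history r v) = min r rounds"
  by (simp add: history_eq)

lemma edges_family: "i < length Gs \<Longrightarrow> edges (Gs ! i) \<subseteq> edges G"
  using family[of "Gs ! i"] by (simp add: subgraph_def)

lemma edge_in_verts: "{u, v} \<in> edges G \<Longrightarrow> u \<in> verts G"
  using wf unfolding wf_ugraph_def by blast

lemma phase_inbox_inp:
  assumes "i < length Gs"
  shows "phase_inbox (inp v) (history r v) i j u =
    (if j < 2 * L \<and> i * (2 * L) + j < min r rounds \<and> {u, v} \<in> edges (Gs ! i)
     then delivered (i * (2 * L) + j) u v else None)"
  using assms by (auto simp: phase_inbox_def length_history) (auto simp: node_input_def history_eq)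

lemma sent_eq:
  "sent r u v =
    (if r < rounds \<and> {u, v} \<in> edges (Gs ! (r div (2 * L)))
     then relay (if u = s then Some m\<^sub>0 else None)
       (phase_inbox (inp u) (history r u) (r div (2 * L))) (r mod (2 * L)) else None)"
proof (cases "r < rounds")
  case True
  then have "0 < L" by (cases L) auto
  then have "r div (2 * L) < length Gs" using True by (simp add: less_mult_imp_div_less mult.commute mult.left_commute)
  then show ?thesis
    using True edges_family[of "r div (2 * L)"]
    by (auto simp: sent_msgs_def decision_inp send_inp length_history Let_def)
next
  case False
  then show ?thesis by (auto simp: sent_msgs_def decision_inp length_history)
qed

definition received :: "nat \<Rightarrow> nat \<Rightarrow> nat \<Rightarrow> inbox" where
  "received i v = phase_inbox (inp v) (history rounds v) i"

lemma received_eq: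
  assumes "i < length Gs"
  shows "received i v j u = (if j < 2 * L \<and> {u, v} \<in> edges (Gs ! i)
     then delivered (i * (2 * L) + j) u v else None)"
proof -
  have "i * (2 * L) + j < rounds" if "j < 2 * L"
  proof -
    have "i * (2 * L) + j < Suc i * (2 * L)" using that by simp
    also have "\<dots> \<le> length Gs * (2 * L)" using assms by (intro mult_le_mono1) simp
    finally show ?thesis by (simp add: algebra_simps)
  qed
  then show ?thesis unfolding received_def phase_inbox_inp[OF assms] by simp
qed

lemma flood_phase_received:
  assumes i: "i < length Gs"
  shows "flood_phase (edges (Gs ! i)) F s m\<^sub>0 (2 * L) (received i)"
proof
  show "{u, v} \<in> edges (Gs ! i) \<and> r < 2 * L" if "received i v r u \<noteq> None" for v r u
    using that by (auto simp: received_eq[OF i] split: if_splits)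
next
  fix u v r assume e: "{u, v} \<in> edges (Gs ! i)" "{u, v} \<notin> F" and r: "r < 2 * L"
  let ?r = "i * (2 * L) + r"
  have d: "?r div (2 * L) = i" "?r mod (2 * L) = r" using r by simp_all
  have "?r < Suc i * (2 * L)" using r by simp
  also have "\<dots> \<le> length Gs * (2 * L)" using i by (intro mult_le_mono1) simp
  finally have "?r < rounds" by (simp add: algebra_simps)
  have "received i v r u = sent ?r u v"
    using e r by (simp add: received_eq[OF i] delivered_def delivered_msgs_def)
  also have "\<dots> = relay (if u = s then Some m\<^sub>0 else None) (phase_inbox (inp u) (history ?r u) i) r"
    unfolding sent_eq d using e \<open>?r < rounds\<close> by simp
  \<comment> \<open>The sender acts on its history before round \<open>?r\<close>, whereas
    \<open>received\<close> reads the complete one; both agree on the earlier rounds of the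
    phase.\<close>
  also have "\<dots> = relay (if u = s then Some m\<^sub>0 else None) (received i u) r"
    using \<open>?r < rounds\<close> by (intro relay_cong ext) (simp add: received_eq[OF i] phase_inbox_inp[OF i])
  finally show "received i v r u = \<dots>" .
qed

text \<open>A forwarded message was either sent earlier, hence the induction on rounds, or forged
  within the bound \<open>B\<close>. Even a forged message comes over a real edge, so the recorded
  parent is a vertex.\<close>

lemma sent_length:
  assumes A: "adversary_respects_bandwidth A B" and m0: "length m\<^sub>0 < B"
    and ids: "\<And>v. v \<in> verts G \<Longrightarrow> length (bits v) < B"
  shows "sent r u v = Some m \<Longrightarrow> length m \<le> B"
proof (induction r arbitrary: u v m rule: less_induct)
  case (less r)
  have dl: "length m \<le> B" if "delivered j u v = Some m" "j < r" for j u v m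
    using that less.IH A
    by (auto simp: delivered_def delivered_msgs_def adversary_respects_bandwidth_def split: if_splits)
  let ?i = "r div (2 * L)"
  let ?g = "phase_inbox (inp u) (history r u) ?i"
  from less.prems have r: "r < rounds" and
    rel: "relay (if u = s then Some m\<^sub>0 else None) ?g (r mod (2 * L)) = Some m"
    unfolding sent_eq by (auto split: if_splits)
  from r have "0 < L" by (cases L) auto
  then have i: "?i < length Gs" using r by (simp add: less_mult_imp_div_less mult.commute mult.left_commute)
  show ?case
  proof (rule relay_length[OF rel])
    show "length (bits w) < B" if "?g j w \<noteq> None" for j w
      using that edges_family[OF i] edge_in_verts[of w u]
      by (intro ids) (auto simp: phase_inbox_inp[OF i] split: if_splits)
    show "length m \<le> B" if "?g j w = Some m" for j w m
      using that dl by (auto simp: phase_inbox_inp[OF i] split: if_splits)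
  qed (use m0 in \<open>auto split: if_splits\<close>)
qed

section \<open>Correctness of the acceptance rule\<close>

lemma accepts_eq:
  "accepts (inp v) (history rounds v) m \<longleftrightarrow>
     (\<forall>E'. finite E' \<and> card E' \<le> t \<longrightarrow>
        (\<exists>i<length Gs. \<exists>qs. claim (received i v) qs m \<and>
           path_edges (v # parent (received i v) # qs) \<inter> E' = {}))"
  by (simp add: accepts_def received_def node_input_def)

text \<open>Instantiating \<open>E'\<close> with \<open>F\<close> yields a claimed path whose edges
  are all honest.\<close>

lemma accepts_sound:
  assumes "finite F" "card F \<le> t" "accepts (inp v) (history rounds v) m"
  shows "m = m\<^sub>0"
proof -
  obtain i qs where "i < length Gs" "claim (received i v) qs m"
    "path_edges (v # parent (received i v) # qs) \<inter> F = {}"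
    using assms unfolding accepts_eq by meson
  then show ?thesis using flood_phase.claim_sound[OF flood_phase_received] by metis
qed

lemma accepts_complete:
  assumes F: "F \<subseteq> edges G" "card F \<le> t" and v: "v \<in> verts G" "v \<noteq> s" and s: "s \<in> verts G"
    and dist: "\<And>E'. E' \<subseteq> edges G \<Longrightarrow> card E' \<le> 2 * t \<Longrightarrow> gdist (del_edges G E') s v \<le> enat L"
    and cov: "covering_family L (2 * t) G Gs"
  shows "accepts (inp v) (history rounds v) m\<^sub>0"
  unfolding accepts_eq
proof (intro allI impI, elim conjE)
  fix E' :: "nat set set" assume E': "finite E'" "card E' \<le> t"
  \<comment> \<open>The covering property speaks of subsets of \<open>edges G\<close> only; the
    intersection loses nothing, as the claimed path will consist of edges of
    \<open>G\<close>.\<close>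
  let ?E = "E' \<inter> edges G \<union> F"
  have E: "?E \<subseteq> edges G" using F by blast
  have "card ?E \<le> card (E' \<inter> edges G) + card F" by (rule card_Un_le)
  also have "\<dots> \<le> 2 * t" using F(2) E' card_mono[of E' "E' \<inter> edges G"] by simp
  finally have card: "card ?E \<le> 2 * t" .
  \<comment> \<open>The strict form turns the bound on an infimum into an actual path.\<close>
  have "gdist (del_edges G ?E) s v < enat (Suc L)"
    using dist[OF E card] by (rule le_less_trans) simp
  then obtain p where p: "is_path (del_edges G ?E) s p v" "path_len p \<le> L"
    unfolding gdist_def INF_less_iff by auto
  have "\<exists>H\<in>set Gs. is_path H s p v \<and> ?E \<inter> edges H = {}"
    using cov s v(1) E card p unfolding covering_family_def by blast
  then obtain i where i: "i < length Gs" and path: "is_path (Gs ! i) s p v"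
    and disj: "?E \<inter> edges (Gs ! i) = {}"
    by (metis in_set_conv_nth)
  interpret flood_phase "edges (Gs ! i)" F s m\<^sub>0 "2 * L" "received i"
    by (rule flood_phase_received[OF i])
  have EF: "edges (Gs ! i) \<inter> F = {}" using disj by blast
  have pv: "p \<noteq> []" "hd p = s" "last p = v" "distinct p"
    "successively (\<lambda>x y. {x, y} \<in> edges (Gs ! i)) p"
    using path by (auto simp: is_path_def)
  have len: "2 \<le> length p" using pv v(2) by (cases p rule: remdups_adj.cases) auto
  \<comment> \<open>The index of \<open>v\<close> on \<open>p\<close> is \<open>Suc d\<close>, so
    \<open>v\<close> is reached by round \<open>d < L\<close>; doubling this bound is why a phase
    has \<open>2 * L\<close> rounds.\<close>
  define d where "d = length p - 2"
  have d: "Suc d < length p" "d < L" "p ! Suc d = v"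
    using len p(2) pv by (auto simp: d_def path_len_def last_conv_nth Suc_diff_Suc numeral_2_eq_2)
  obtain j u where j: "j \<le> d" "received i v j u \<noteq> None"
    using reached_along_path[OF EF pv(4,2,5) d(1)] d by auto
  have "first_round (received i v) \<le> d" using first_round_le[of "received i v" j u] j by simp
  then obtain qs m where qs: "claim (received i v) qs m"
    "path_edges (v # parent (received i v) # qs) \<subseteq> edges (Gs ! i)"
    using claim_complete[OF EF j(2)] d(2) by auto
  moreover have "m = m\<^sub>0" using claim_sound[OF qs(1)] qs(2) EF by blast
  moreover have "path_edges (v # parent (received i v) # qs) \<inter> E' = {}"
    using qs(2) disj edges_family[OF i] by blast
  ultimately show "\<exists>i<length Gs. \<exists>qs. claim (received i v) qs m\<^sub>0 \<and>
      path_edges (v # parent (received i v) # qs) \<inter> E' = {}"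
    using i by blast
qed

end

lemma lg_pos: "0 < n \<Longrightarrow> 0 < lg n"
  by (simp add: lg_def)

theorem theorem5:
  fixes c\<^sub>i\<^sub>d c\<^sub>m c\<^sub>e :: nat
  shows "\<exists>(P :: protocol) (c\<^sub>B :: nat) (c\<^sub>T :: nat).
    \<forall>(G :: nat ugraph) (s :: nat) (m\<^sub>0 :: msg) (N :: nat) (t :: nat) (D :: nat) (L :: nat)
      (Gs :: nat ugraph list).
      congest_network c\<^sub>i\<^sub>d c\<^sub>m c\<^sub>e G s m\<^sub>0 N \<longrightarrow>
      edge_connected (2 * t + 1) G \<longrightarrow>
      diameter G = enat D \<longrightarrow>
      (\<forall>u\<in>verts G. \<forall>v\<in>verts G. \<forall>E'\<subseteq>edges G.
         card E' \<le> 2 * t \<longrightarrow> gdist (del_edges G E') u v \<le> enat L) \<longrightarrow>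
      covering_family L (2 * t) G Gs \<longrightarrow>
      broadcasts P (node_input G s m\<^sub>0 N t L Gs) G m\<^sub>0 t
        (c\<^sub>B * lg (card (verts G))) (c\<^sub>T * (L * length Gs))"
proof (rule exI[of _ flood_protocol], rule exI[of _ "c\<^sub>i\<^sub>d + c\<^sub>m + 1"], rule exI[of _ 2],
    intro allI impI)
  fix G :: "nat ugraph" and s :: nat and m\<^sub>0 :: msg and N t D L :: nat and Gs :: "nat ugraph list"
  assume net: "congest_network c\<^sub>i\<^sub>d c\<^sub>m c\<^sub>e G s m\<^sub>0 N"
    and dist: "\<forall>u\<in>verts G. \<forall>v\<in>verts G. \<forall>E'\<subseteq>edges G.
      card E' \<le> 2 * t \<longrightarrow> gdist (del_edges G E') u v \<le> enat L"
    and cov: "covering_family L (2 * t) G Gs"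
  let ?l = "lg (card (verts G))"
  \<comment> \<open>The summands pay for an identifier, the message and the tag bit; since
    \<open>?l\<close> is positive, both payloads are strictly shorter than
    \<open>?B\<close>.\<close>
  let ?B = "(c\<^sub>i\<^sub>d + c\<^sub>m + 1) * ?l"
  have wf: "wf_ugraph G" and s: "s \<in> verts G"
    and ids: "\<And>v. v \<in> verts G \<Longrightarrow> v < 2 ^ (c\<^sub>i\<^sub>d * ?l)" and m0: "length m\<^sub>0 \<le> c\<^sub>m * ?l"
    using net by (auto simp: congest_network_def Let_def)
  have "finite (verts G)" using wf by (simp add: wf_ugraph_def)
  then have "0 < ?l" using s by (intro lg_pos) (auto simp: card_gt_0_iff)
  then have id_len: "length (bits v) < ?B" if "v \<in> verts G" for v
    using length_bits_le[OF ids[OF that]] by (simp add: algebra_simps)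
  have m0_len: "length m\<^sub>0 < ?B" using m0 \<open>0 < ?l\<close> by (simp add: algebra_simps)
  have "edges G \<subseteq> Pow (verts G)" using wf by (auto simp: wf_ugraph_def)
  then have fin: "finite (edges G)" using \<open>finite (verts G)\<close> by (simp add: finite_subset)
  show "broadcasts flood_protocol (node_input G s m\<^sub>0 N t L Gs) G m\<^sub>0 t ?B (2 * (L * length Gs))"
    unfolding broadcasts_def
  proof (intro allI impI, elim conjE, intro conjI ballI)
    fix F A assume F: "F \<subseteq> edges G" "card F \<le> t" and A: "adversary_respects_bandwidth A ?B"
    interpret flooding G s m\<^sub>0 N t L Gs F A
      using wf cov by unfold_locales (simp_all add: covering_family_def)
    show "respects_bandwidth flood_protocol inp G F A ?B"
      using sent_length[OF A m0_len id_len] unfolding respects_bandwidth_def by blast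
    fix v assume v: "v \<in> verts G"
    show "output_after flood_protocol inp G F A rounds v = Some m\<^sub>0"
    proof (cases "v = s")
      case True
      then show ?thesis by (simp add: output_after_def decision_inp length_history)
    next
      case False
      have "accepts (inp v) (history rounds v) m\<^sub>0"
        using accepts_complete[OF F v False s _ cov] dist s v by blast
      moreover have "finite F" using F(1) fin by (rule finite_subset)
      \<comment> \<open>Exactly one message is accepted, so the choice is forced.\<close>
      ultimately have "(SOME m. accepts (inp v) (history rounds v) m) = m\<^sub>0"
        using accepts_sound[OF _ F(2)] by (intro some_equality) blast+
      then show ?thesis using False by (simp add: output_after_def decision_inp length_history)
    qed
  qed
qed

end
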